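(* Let $G=(V,E,\omega)$ be a finite directed non-negatively weighted graph, $r\in V$ and $k>0$ an integer, and let $S=\{S_{rv}\}_{v\in V}$ be a solution to the Single-Source Top-$k$ Simple Shortest Paths problem for $G,r,k$. Let $v,w\in V$ and let $P_{rw}=P_{rv}\oplus P_{vw}$ be a path from $r$ to $w$ (with $P_{rv}$ a path from $r$ to $v$ and $P_{vw}$ a path from $v$ to $w$) such that $P_{rw}\in S'_{rw}$ for every $S'_{rw}\in\Gamma_{rw}$, and $P_{rv}\notin S_{rv}$. Then there exist two vertices $t,y\in V(P_{vw})\cap A_{S,v}$ such that: (i) $y\in V(S_{rt})$; (ii) $P_{rt}=P_{rv}\oplus P_{vt}\notin S_{rt}$; and (iii) $P_{ry}=P_{rv}\oplus P_{vy}\in S_{ry}$, where $P_{vt}$ and $P_{vy}$ are the prefixes of $P_{vw}$ ending at $t$ and $y$, respectively.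
   Context: $G=(V,E,\omega)$ is a finite directed graph, $E\subseteq V\times V$, with non-negative real edge weights $\omega$. A path from $s$ to $t$ is a vertex sequence $P=(s=v_1,\dots,v_\eta=t)$, $\eta\ge 1$, with $(v_i,v_{i+1})\in E$ for all $i<\eta$; $V(P)$ is its vertex set; it is simple if it has no repeated vertex; its weight is $\omega(P)=\sum_{i=1}^{\eta-1}\omega(v_i,v_{i+1})$. If $P'$ ends at the first vertex of $P''$, then $P'\oplus P''$ denotes their concatenation; $P'$ is a prefix of $P$ if $P=P'\oplus Q$ for some (possibly empty) $Q$. A collection of top-$k$ simple shortest paths from $r$ to $v$ is a set of pairwise distinct simple paths from $r$ to $v$ that contains all simple $r$–$v$ paths if there are fewer than $k$ of them, and otherwise contains exactly $k$ simple $r$–$v$ paths such that every simple $r$–$v$ path not in the set has weight at least that of every path in the set. $\Gamma_{rv}$ is the family of all such collections ($\Gamma_{rr}=\{\{(r)\}\}$). A solution to the Single-Source Top-$k$ Simple Shortest Paths problem is a family $S=\{S_{rv}\}_{v\in V}$ with $S_{rv}\in\Gamma_{rv}$ for every $v\in V$. $V(S_{rv})$ denotes the set of predecessors of $v$ in $S$: the vertices $u\neq v$ that lie on some path of $S_{rv}$. Write $u\,R_S\,v$ if $u\in V(S_{rv})$, and let $T_S$ be the transitive closure of $R_S$. The set of general predecessors of $v$ is $A_{S,v}=\{u: u\,T_S\,v\}\cup\{v\}$. *)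

theory Defs
  imports Complex_Main "Graph_Theory.Pair_Digraph" "Graph_Theory.Vertex_Walk"
begin

(* A path is a nonempty vertex list; vwalk_join P Q = P @ tl Q is the concatenation
   of P and Q when joinable P Q holds, i.e. when last P = hd Q. *)

definition paths :: "'a pair_pre_digraph \<Rightarrow> 'a \<Rightarrow> 'a \<Rightarrow> 'a list set" where
  "paths G s t = {P. vwalk P (with_proj G) \<and> hd P = s \<and> last P = t}"

definition simple_paths :: "'a pair_pre_digraph \<Rightarrow> 'a \<Rightarrow> 'a \<Rightarrow> 'a list set" where
  "simple_paths G s t = {P \<in> paths G s t. distinct P}"

definition weight :: "('a \<times> 'a \<Rightarrow> real) \<Rightarrow> 'a list \<Rightarrow> real" where
  "weight \<omega> P = sum_list (map \<omega> (vwalk_arcs P))"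

(* The empty remainder corresponds to the one-vertex path Q = [last P']. *)
definition is_prefix :: "'a list \<Rightarrow> 'a list \<Rightarrow> bool" where
  "is_prefix P' P \<longleftrightarrow> (\<exists>Q. joinable P' Q \<and> P = vwalk_join P' Q)"

(* The family Gamma_rv. The test on card is meaningful because simple_paths G r v
   is finite for a finite graph; see finite_simple_paths. *)
definition top_k_collections ::
  "'a pair_pre_digraph \<Rightarrow> ('a \<times> 'a \<Rightarrow> real) \<Rightarrow> nat \<Rightarrow> 'a \<Rightarrow> 'a \<Rightarrow> 'a list set set" where
  "top_k_collections G \<omega> k r v =
     {C. C \<subseteq> simple_paths G r v \<and>
         (if card (simple_paths G r v) < k then C = simple_paths G r v
          else card C = k \<and>
               (\<forall>P \<in> simple_paths G r v - C. \<forall>Q \<in> C. weight \<omega> Q \<le> weight \<omega> P))}"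

definition is_solution ::
  "'a pair_pre_digraph \<Rightarrow> ('a \<times> 'a \<Rightarrow> real) \<Rightarrow> nat \<Rightarrow> 'a \<Rightarrow> ('a \<Rightarrow> 'a list set) \<Rightarrow> bool" where
  "is_solution G \<omega> k r S \<longleftrightarrow> (\<forall>v \<in> pverts G. S v \<in> top_k_collections G \<omega> k r v)"

(* V(S_rv), where S v stands for S_rv. *)
definition predecessors :: "('a \<Rightarrow> 'a list set) \<Rightarrow> 'a \<Rightarrow> 'a set" where
  "predecessors S v = {u. u \<noteq> v \<and> (\<exists>P \<in> S v. u \<in> set P)}"

(* The restriction to pverts G discards the values of S outside the vertex set,
   which is_solution leaves unconstrained. *)
definition pred_rel :: "'a pair_pre_digraph \<Rightarrow> ('a \<Rightarrow> 'a list set) \<Rightarrow> 'a rel" where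
  "pred_rel G S = {(u, v). u \<in> pverts G \<and> v \<in> pverts G \<and> u \<in> predecessors S v}"

definition general_predecessors ::
  "'a pair_pre_digraph \<Rightarrow> ('a \<Rightarrow> 'a list set) \<Rightarrow> 'a \<Rightarrow> 'a set" where
  "general_predecessors G S v = {u. (u, v) \<in> (pred_rel G S)\<^sup>+} \<union> {v}"

lemma finite_simple_paths:
  assumes "pair_fin_digraph G"
  shows "finite (simple_paths G s t)"
proof -
  have "finite (pverts G)" using assms by (rule pair_fin_digraph.pair_finite_verts)
  then have "finite {P. set P \<subseteq> pverts G \<and> distinct P}"
    by (rule finite_subset_distinct)
  moreover have "simple_paths G s t \<subseteq> {P. set P \<subseteq> pverts G \<and> distinct P}"
    by (auto simp: simple_paths_def paths_def vwalk_def)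
  ultimately show ?thesis by (rule rev_finite_subset)
qed

lemma simple_paths_same:
  assumes "r \<in> pverts G"
  shows "simple_paths G r r = {[r]}"
proof -
  have "P = [r]" if "P \<in> simple_paths G r r" for P
    using that by (cases P) (auto simp: simple_paths_def paths_def vwalk_def split: if_splits)
  then show ?thesis
    using assms by (auto simp: simple_paths_def paths_def vwalk_def)
qed

lemma top_k_collections_same:
  assumes "r \<in> pverts G" "k > 0"
  shows "top_k_collections G \<omega> k r r = {{[r]}}"
  using assms by (auto simp: top_k_collections_def simple_paths_same subset_singleton_iff)

end

theory Submission
  imports Defs
begin

text \<open>Call a vertex \<open>x\<close> of \<open>P_vw\<close> that lies in \<open>A\<^bsub>S,v\<^esub>\<close> bad if \<open>P_rx \<notin> S x\<close>; the vertex
  \<open>v\<close> is bad. If no pair \<open>t\<close>, \<open>y\<close> as required exists, then every vertex of \<open>P_vw\<close> preceding a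
  bad vertex in \<open>S\<close> is bad too. So for the last bad vertex \<open>t\<close> of \<open>P_vw\<close>, the
  paths in \<open>S t\<close> avoid the part of \<open>P_vw\<close> after \<open>t\<close>. As \<open>P_rt \<notin> S t\<close>, there are \<open>k\<close> of them,
  none heavier than \<open>P_rt\<close>, and extending them along \<open>P_vw\<close> gives \<open>k\<close> simple paths to \<open>w\<close>, different
  from \<open>P_rw\<close> and none heavier. Hence some top-\<open>k\<close> collection omits \<open>P_rw\<close>.\<close>

text \<open>Greedy choice: starting from the empty set, a minimum of the remaining elements is added
  \<open>k\<close> times.\<close>

lemma exists_k_smallest:
  fixes f :: "'b \<Rightarrow> 'c::linorder"
  assumes "finite X" "k \<le> card X"
  shows "\<exists>C \<subseteq> X. card C = k \<and> (\<forall>x \<in> X - C. \<forall>c \<in> C. f c \<le> f x)"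
  using assms(2)
proof (induction k)
  case 0
  then show ?case by (intro exI[of _ "{}"]) auto
next
  case (Suc k)
  then obtain C where C: "C \<subseteq> X" "card C = k" "\<forall>x \<in> X - C. \<forall>c \<in> C. f c \<le> f x"
    by auto
  have fin: "finite (X - C)" "finite C"
    using assms(1) C(1) by (auto intro: finite_subset)
  have "X - C \<noteq> {}"
    using card_mono[OF fin(2), of X] C(2) Suc.prems by auto
  define m where "m = arg_min_on f (X - C)"
  have m: "m \<in> X - C" "\<And>x. x \<in> X - C \<Longrightarrow> f m \<le> f x"
    unfolding m_def using fin(1) \<open>X - C \<noteq> {}\<close>
    by (rule arg_min_if_finite(1), rule arg_min_least)
  have "insert m C \<subseteq> X" "card (insert m C) = Suc k"
    using C(1,2) m(1) fin(2) by simp_all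
  moreover have "f c \<le> f x" if "x \<in> X - insert m C" "c \<in> insert m C" for x c
    using that C(3) m(2) by blast
  ultimately show ?case by blast
qed

text \<open>The \<open>k\<close> smallest elements of \<open>X - {p}\<close> also lie below
  \<open>p\<close>: a chosen element in \<open>D\<close> does by assumption, and if some choice lies
  outside \<open>D\<close>, then some \<open>d\<close> in \<open>D\<close> was left out, so every
  choice is at most \<open>f d\<close>, hence at most \<open>f p\<close>.\<close>

lemma exists_k_smallest_avoiding:
  fixes f :: "'b \<Rightarrow> 'c::linorder"
  assumes "finite X" "D \<subseteq> X - {p}" "card D = k" "\<forall>d \<in> D. f d \<le> f p"
  shows "\<exists>C \<subseteq> X - {p}. card C = k \<and> (\<forall>x \<in> X - C. \<forall>c \<in> C. f c \<le> f x)"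
proof -
  have "k \<le> card (X - {p})"
    using assms by (metis card_mono finite_Diff)
  then obtain C where C: "C \<subseteq> X - {p}" "card C = k" "\<forall>x \<in> X - {p} - C. \<forall>c \<in> C. f c \<le> f x"
    using exists_k_smallest[of "X - {p}" k f] assms(1) by auto
  have "f c \<le> f p" if c: "c \<in> C" for c
  proof (cases "C \<subseteq> D")
    case True
    then show ?thesis using c assms(4) by blast
  next
    case False
    have "finite C" using C(1) assms(1) by (metis finite_Diff finite_subset)
    then have "\<not> D \<subseteq> C" using False C(2) assms(3) by (metis card_subset_eq)
    then obtain d where "d \<in> D" "d \<notin> C" by blast
    then show ?thesis using C(3) assms(2,4) c by (meson Diff_iff order_trans subsetD)
  qed
  then show ?thesis using C by blast
qed

text \<open>The \<open>k\<close> competitors in \<open>D\<close> allow ties to be broken against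
  \<open>P\<close>. In the theorem this contradicts the membership of \<open>P_rw\<close> in every
  collection.\<close>

lemma exists_top_k_collection_avoiding:
  assumes "pair_fin_digraph G" "D \<subseteq> simple_paths G r w - {P}" "card D = k"
    and "\<forall>Q \<in> D. weight \<omega> Q \<le> weight \<omega> P"
  shows "\<exists>C \<in> top_k_collections G \<omega> k r w. P \<notin> C"
proof -
  have fin: "finite (simple_paths G r w)" using assms(1) by (rule finite_simple_paths)
  obtain C where C: "C \<subseteq> simple_paths G r w - {P}" "card C = k"
    "\<forall>x \<in> simple_paths G r w - C. \<forall>c \<in> C. weight \<omega> c \<le> weight \<omega> x"
    using exists_k_smallest_avoiding[OF fin assms(2-4)] by blast
  \<comment> \<open>This excludes the case of the definition in which the collection must contain
    all simple paths.\<close>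
  have "k \<le> card (simple_paths G r w)"
    using C fin by (metis Diff_subset card_mono order_trans)
  then show ?thesis
    using C by (intro bexI[of _ C]) (auto simp: top_k_collections_def)
qed

text \<open>Repeating \<open>last Q\<close> in the second part keeps the arc that joins
  \<open>Q\<close> to \<open>qs\<close>.\<close>

lemma vwalk_arcs_append_overlap:
  "Q \<noteq> [] \<Longrightarrow> vwalk_arcs (Q @ qs) = vwalk_arcs Q @ vwalk_arcs (last Q # qs)"
  by (induction Q rule: vwalk_arcs.induct) auto

lemma weight_append:
  "Q \<noteq> [] \<Longrightarrow> weight \<omega> (Q @ qs) = weight \<omega> Q + weight \<omega> (last Q # qs)"
  by (simp add: weight_def vwalk_arcs_append_overlap)

lemma paths_splitD:
  assumes "as @ x # bs \<in> paths G s t"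
  shows "as @ [x] \<in> paths G s x" "x # bs \<in> paths G x t"
proof -
  have "vwalk_arcs (as @ x # bs) = vwalk_arcs (as @ [x]) @ vwalk_arcs (x # bs)"
    using vwalk_arcs_append_overlap[of "as @ [x]" bs] by simp
  moreover have "hd (as @ x # bs) = hd (as @ [x])" "last (as @ x # bs) = last (x # bs)"
    by (simp_all add: hd_append)
  ultimately show "as @ [x] \<in> paths G s x" "x # bs \<in> paths G x t"
    using assms by (simp_all add: paths_def vwalk_def)
qed

lemma paths_append:
  assumes "Q \<in> paths G s x" "x # bs \<in> paths G x t"
  shows "Q @ bs \<in> paths G s t"
proof -
  from assms(1) have Q: "Q \<noteq> []" "last Q = x" by (auto simp: paths_def vwalk_def)
  then have "vwalk_arcs (Q @ bs) = vwalk_arcs Q @ vwalk_arcs (x # bs)"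
    by (simp add: vwalk_arcs_append_overlap)
  moreover have "last (Q @ bs) = last (x # bs)" using Q by simp
  ultimately show ?thesis
    using assms Q(1) by (simp add: paths_def vwalk_def)
qed

lemma is_prefix_splitI: "is_prefix (as @ [x]) (as @ x # bs)"
  unfolding is_prefix_def joinable_def vwalk_join_def
  by (rule exI[of _ "x # bs"]) simp

text \<open>One more step of \<open>pred_rel\<close> is put in front of a chain from
  \<open>t\<close> to \<open>v\<close>, which is empty if \<open>t = v\<close>.\<close>

lemma general_predecessors_step:
  assumes "t \<in> general_predecessors G S v" "y \<in> predecessors S t"
    and "t \<in> pverts G" "y \<in> pverts G"
  shows "y \<in> general_predecessors G S v"
proof -
  have "(y, t) \<in> pred_rel G S" using assms by (simp add: pred_rel_def)
  then show ?thesis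
    using assms(1) by (auto simp: general_predecessors_def intro: trancl_into_trancl2)
qed

text \<open>A collection that omits a simple path is not exhaustive, so it falls under the second
  case of the definition.\<close>

lemma top_k_collections_omitted:
  assumes "C \<in> top_k_collections G \<omega> k r v" "P \<in> simple_paths G r v" "P \<notin> C"
  shows "card C = k" "\<And>Q. Q \<in> C \<Longrightarrow> weight \<omega> Q \<le> weight \<omega> P"
  using assms by (auto simp: top_k_collections_def split: if_splits)

theorem lemma5:
  fixes G :: "'a pair_pre_digraph"
    and \<omega> :: "'a \<times> 'a \<Rightarrow> real"
    and k :: nat
    and r v w :: 'a
    and S :: "'a \<Rightarrow> 'a list set"
    and P_rv P_vw P_rw :: "'a list"
  assumes "pair_fin_digraph G"
    and "\<And>e. e \<in> parcs G \<Longrightarrow> 0 \<le> \<omega> e"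
    and "r \<in> pverts G"
    and "k > 0"
    and "is_solution G \<omega> k r S"
    and "v \<in> pverts G"
    and "w \<in> pverts G"
    and "P_rv \<in> paths G r v"
    and "P_vw \<in> paths G v w"
    and "P_rw = vwalk_join P_rv P_vw"
    and "\<And>S'. S' \<in> top_k_collections G \<omega> k r w \<Longrightarrow> P_rw \<in> S'"
    and "P_rv \<notin> S v"
  shows "\<exists>t y P_vt P_vy.
      t \<in> set P_vw \<inter> general_predecessors G S v \<and>
      y \<in> set P_vw \<inter> general_predecessors G S v \<and>
      P_vt \<in> paths G v t \<and> is_prefix P_vt P_vw \<and>
      P_vy \<in> paths G v y \<and> is_prefix P_vy P_vw \<and>
      y \<in> predecessors S t \<and>
      vwalk_join P_rv P_vt \<notin> S t \<and>
      vwalk_join P_rv P_vy \<in> S y"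
proof (rule ccontr)
  assume contra: "\<not> ?thesis"
  define bad where "bad x \<longleftrightarrow> x \<in> general_predecessors G S v \<and>
    (\<exists>as bs. P_vw = as @ x # bs \<and> vwalk_join P_rv (as @ [x]) \<notin> S x)" for x
  have S: "S x \<in> top_k_collections G \<omega> k r x" if "x \<in> pverts G" for x
    using assms(5) that by (auto simp: is_solution_def)
  have P_rv: "P_rv \<noteq> []" "last P_rv = v"
    using assms(8) by (auto simp: paths_def vwalk_def)
  have P_vw: "P_vw \<noteq> []" "hd P_vw = v" "set P_vw \<subseteq> pverts G"
    using assms(9) by (auto simp: paths_def vwalk_def)
  \<comment> \<open>\<open>S w\<close> is itself a top-\<open>k\<close> collection, which makes
    \<open>P_rw\<close> simple.\<close>
  have "P_rw \<in> S w" using assms(11) S assms(7) by blast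
  then have P_rw: "P_rw \<in> simple_paths G r w"
    using S[OF assms(7)] by (auto simp: top_k_collections_def split: if_splits)
  \<comment> \<open>Concatenation drops the head \<open>v\<close> of \<open>P_vw\<close>; it cannot
    recur in the tail because it lies on \<open>P_rv\<close>.\<close>
  have "set P_rv \<inter> set (tl P_vw) = {}" "distinct P_rv" "distinct (tl P_vw)"
    using P_rw assms(10) by (auto simp: simple_paths_def vwalk_join_def)
  moreover have "v \<in> set P_rv" using P_rv by (metis last_in_set)
  ultimately have "distinct P_vw"
    using P_vw by (cases P_vw) auto

  have "bad v"
  proof -
    have "P_vw = [] @ v # tl P_vw" using P_vw by (cases P_vw) auto
    moreover have "vwalk_join P_rv ([] @ [v]) \<notin> S v"
      using assms(12) by (simp add: vwalk_join_def)
    ultimately show ?thesis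
      unfolding bad_def general_predecessors_def by blast
  qed
  moreover have "v \<in> set P_vw" using P_vw by (metis hd_in_set)
  ultimately obtain as t bs where split: "P_vw = as @ t # bs" and "bad t"
    and last: "\<forall>z \<in> set bs. \<not> bad z"
    using split_list_last_propE[of P_vw bad] by blast
  define P_rt where "P_rt = vwalk_join P_rv (as @ [t])"
  have t: "t \<in> general_predecessors G S v" "t \<in> pverts G" "P_rt \<notin> S t"
  proof -
    from \<open>bad t\<close> obtain as' bs' where "P_vw = as' @ t # bs'" "vwalk_join P_rv (as' @ [t]) \<notin> S t"
      and "t \<in> general_predecessors G S v"
      unfolding bad_def by blast
    \<comment> \<open>\<open>bad\<close> hides its split behind an existential; as
      \<open>P_vw\<close> is distinct, it splits at \<open>t\<close> in only one way.\<close>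
    moreover have "as' = as"
      using calculation(1) split \<open>distinct P_vw\<close> by (metis append_Cons_eq_iff distinct_append
        distinct.simps(2) not_distinct_conv_prefix)
    ultimately show "t \<in> general_predecessors G S v" "P_rt \<notin> S t"
      by (auto simp: P_rt_def)
    show "t \<in> pverts G" using P_vw(3) split by auto
  qed
  have walks: "as @ [t] \<in> paths G v t" "t # bs \<in> paths G t w"
    using paths_splitD assms(9) unfolding split by metis+
  have P_rt_append: "P_rw = P_rt @ bs"
    using assms(10) by (cases as) (auto simp: P_rt_def split vwalk_join_def)
  have "P_rt \<in> paths G r t"
  proof -
    have "v # tl (as @ [t]) = as @ [t]"
      using P_vw split by (cases as) auto
    then show ?thesis
      unfolding P_rt_def vwalk_join_def using paths_append[OF assms(8)] walks(1) by metis
  qed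
  then have P_rt: "P_rt \<in> simple_paths G r t"
    using P_rw P_rt_append by (auto simp: simple_paths_def)

  have disjoint: "set Q \<inter> set bs = {}" if "Q \<in> S t" for Q
  proof (rule ccontr)
    assume "set Q \<inter> set bs \<noteq> {}"
    then obtain y where y: "y \<in> set Q" "y \<in> set bs" by blast
    then have "y \<noteq> t" using \<open>distinct P_vw\<close> split by auto
    then have pred: "y \<in> predecessors S t" using y that by (auto simp: predecessors_def)
    have "y \<in> set P_vw" using y split by auto
    then have gen: "y \<in> general_predecessors G S v"
      using general_predecessors_step[OF t(1) pred t(2)] P_vw(3) by blast
    obtain as' bs' where split': "P_vw = as' @ y # bs'"
      using \<open>y \<in> set P_vw\<close> by (metis split_list)
    \<comment> \<open>Otherwise \<open>t\<close> and \<open>y\<close> would be a pair excluded by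
      \<open>contra\<close>. Hence \<open>y\<close> is bad, although it comes after the last bad
      vertex \<open>t\<close>.\<close>
    have "vwalk_join P_rv (as' @ [y]) \<notin> S y"
    proof
      assume "vwalk_join P_rv (as' @ [y]) \<in> S y"
      moreover have "as' @ [y] \<in> paths G v y"
        using paths_splitD(1) assms(9) unfolding split' by metis
      moreover have "is_prefix (as' @ [y]) P_vw" "is_prefix (as @ [t]) P_vw"
        using is_prefix_splitI split split' by metis+
      moreover have "t \<in> set P_vw" using split by simp
      ultimately show False
        using contra t(1,3) gen pred walks(1) \<open>y \<in> set P_vw\<close> unfolding P_rt_def by blast
    qed
    then have "bad y" using gen split' unfolding bad_def by blast
    then show False using last y(2) by blast
  qed

  define D where "D = (\<lambda>Q. Q @ bs) ` S t"
  have S_t: "S t \<subseteq> simple_paths G r t"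
    using S[OF t(2)] by (simp add: top_k_collections_def)
  have "card D = k"
    using top_k_collections_omitted(1)[OF S[OF t(2)] P_rt t(3)]
    by (simp add: D_def card_image inj_on_def)
  moreover have "D \<subseteq> simple_paths G r w - {P_rw}"
  proof -
    have "Q @ bs \<in> simple_paths G r w" if "Q \<in> S t" for Q
    proof -
      have "Q @ bs \<in> paths G r w"
        using S_t that walks(2) by (auto simp: simple_paths_def intro: paths_append)
      then show ?thesis
        using S_t that disjoint[OF that] \<open>distinct P_vw\<close> split by (auto simp: simple_paths_def)
    qed
    \<comment> \<open>Cancelling \<open>bs\<close> in \<open>Q @ bs = P_rt @ bs\<close> would put
      \<open>P_rt\<close> into \<open>S t\<close>.\<close>
    then show ?thesis using t(3) P_rt_append by (auto simp: D_def)
  qed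
  moreover have "\<forall>R \<in> D. weight \<omega> R \<le> weight \<omega> P_rw"
  proof -
    have ends: "Q \<noteq> [] \<and> last Q = t" if "Q \<in> simple_paths G r t" for Q
      using that by (auto simp: simple_paths_def paths_def vwalk_def)
    \<comment> \<open>Both paths continue from \<open>t\<close> along \<open>t # bs\<close>, so the
      comparison reduces to that of \<open>Q\<close> with \<open>P_rt\<close>.\<close>
    have "weight \<omega> (Q @ bs) \<le> weight \<omega> P_rw" if "Q \<in> S t" for Q
      using top_k_collections_omitted(2)[OF S[OF t(2)] P_rt t(3) that] ends[OF P_rt]
        ends[OF subsetD[OF S_t that]] by (simp add: P_rt_append weight_append)
    then show ?thesis by (auto simp: D_def)
  qed
  ultimately show False
    using exists_top_k_collection_avoiding[OF assms(1)] assms(11) by metis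
qed

end
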